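(* Let $G$ be a $3$-connected graph. If $\sigma_2(G)\ge 2\widetilde{\alpha}(G)+1$, then $G$ is hamiltonian-connected, i.e., for every two distinct vertices $x,y$ of $G$ there is a path from $x$ to $y$ containing every vertex of $G$.
   Context: All graphs are finite and simple. For a graph $G$ that is not complete, $\sigma_2(G)=\min\{d_G(u)+d_G(v): u,v\in V(G),\ u\ne v,\ uv\notin E(G)\}$; if $G$ is complete, $\sigma_2(G)=\infty$. An $(s,t)$-bipartite-hole in $G$ consists of two disjoint vertex sets $S,T\subseteq V(G)$ with $|S|=s$, $|T|=t$ and no edge of $G$ having one endpoint in $S$ and the other in $T$. The bipartite-hole-number $\widetilde{\alpha}(G)$ is the minimum integer $k$ such that there exist positive integers $s,t$ with $s+t=k+1$ for which $G$ contains no $(s,t)$-bipartite-hole. *)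

theory Defs
  imports Main "HOL-Library.Extended_Nat"
begin

definition graph :: "'a set \<Rightarrow> ('a \<Rightarrow> 'a \<Rightarrow> bool) \<Rightarrow> bool" where
  "graph V E \<longleftrightarrow> finite V \<and> (\<forall>u v. E u v \<longrightarrow> u \<in> V \<and> v \<in> V)
     \<and> (\<forall>u v. E u v \<longrightarrow> E v u) \<and> (\<forall>u. \<not> E u u)"

definition degree :: "'a set \<Rightarrow> ('a \<Rightarrow> 'a \<Rightarrow> bool) \<Rightarrow> 'a \<Rightarrow> nat" where
  "degree V E u = card {v \<in> V. E u v}"

definition connected_on :: "'a set \<Rightarrow> ('a \<Rightarrow> 'a \<Rightarrow> bool) \<Rightarrow> bool" where
  "connected_on S E \<longleftrightarrow> S \<noteq> {} \<and>
     (\<forall>u\<in>S. \<forall>v\<in>S. (\<lambda>a b. E a b \<and> a \<in> S \<and> b \<in> S)\<^sup>*\<^sup>* u v)"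

definition k_connected :: "nat \<Rightarrow> 'a set \<Rightarrow> ('a \<Rightarrow> 'a \<Rightarrow> bool) \<Rightarrow> bool" where
  "k_connected k V E \<longleftrightarrow> card V > k \<and>
     (\<forall>X. X \<subseteq> V \<and> card X < k \<longrightarrow> connected_on (V - X) E)"

definition complete_graph :: "'a set \<Rightarrow> ('a \<Rightarrow> 'a \<Rightarrow> bool) \<Rightarrow> bool" where
  "complete_graph V E \<longleftrightarrow> (\<forall>u\<in>V. \<forall>v\<in>V. u \<noteq> v \<longrightarrow> E u v)"

definition sigma2 :: "'a set \<Rightarrow> ('a \<Rightarrow> 'a \<Rightarrow> bool) \<Rightarrow> enat" where
  "sigma2 V E = (if complete_graph V E then \<infinity>
     else enat (Min {degree V E u + degree V E v | u v. u \<in> V \<and> v \<in> V \<and> u \<noteq> v \<and> \<not> E u v}))"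

definition bipartite_hole :: "'a set \<Rightarrow> ('a \<Rightarrow> 'a \<Rightarrow> bool) \<Rightarrow> nat \<Rightarrow> nat \<Rightarrow> bool" where
  "bipartite_hole V E s t \<longleftrightarrow> (\<exists>S T. S \<subseteq> V \<and> T \<subseteq> V \<and> S \<inter> T = {} \<and>
     card S = s \<and> card T = t \<and> (\<forall>x\<in>S. \<forall>y\<in>T. \<not> E x y))"

definition bip_hole_number :: "'a set \<Rightarrow> ('a \<Rightarrow> 'a \<Rightarrow> bool) \<Rightarrow> nat" where
  "bip_hole_number V E = (LEAST k. \<exists>s t. s > 0 \<and> t > 0 \<and> s + t = k + 1 \<and>
     \<not> bipartite_hole V E s t)"

definition is_path :: "'a set \<Rightarrow> ('a \<Rightarrow> 'a \<Rightarrow> bool) \<Rightarrow> 'a list \<Rightarrow> 'a \<Rightarrow> 'a \<Rightarrow> bool" where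
  "is_path V E p x y \<longleftrightarrow> p \<noteq> [] \<and> hd p = x \<and> last p = y \<and> distinct p \<and>
     set p \<subseteq> V \<and> (\<forall>i. Suc i < length p \<longrightarrow> E (p ! i) (p ! Suc i))"

definition hamiltonian_connected :: "'a set \<Rightarrow> ('a \<Rightarrow> 'a \<Rightarrow> bool) \<Rightarrow> bool" where
  "hamiltonian_connected V E \<longleftrightarrow> (\<forall>x\<in>V. \<forall>y\<in>V. x \<noteq> y \<longrightarrow>
     (\<exists>p. is_path V E p x y \<and> set p = V))"

end

theory Submission
  imports Defs
begin

text \<open>
  Let \<open>a\<close> be the bipartite-hole-number and choose positive \<open>s\<close>, \<open>t\<close> with \<open>s + t = a + 1\<close> such that there
  is no \<open>(s, t)\<close>-hole. Call a vertex high if its degree is at least \<open>a + 1\<close>. Vertices that are not high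
  are pairwise adjacent by the hypothesis on degree sums. If the high vertices are pairwise adjacent
  too, then the graph is covered by two disjoint cliques, and 3-connectedness supplies the edges
  between them that a Hamiltonian \<open>x\<close>-\<open>y\<close> path needs. Otherwise join two nonadjacent high
  vertices \<open>u\<close>, \<open>v\<close>; all hypotheses persist, so by induction on the number of non-edges there is
  a Hamiltonian \<open>x\<close>-\<open>y\<close> path using the new edge \<open>uv\<close>. Deleting \<open>uv\<close> and joining \<open>x\<close> to \<open>y\<close> turns it
  into a Hamiltonian \<open>u\<close>-\<open>v\<close> path through \<open>xy\<close>. If no Hamiltonian \<open>x\<close>-\<open>y\<close> path existed, rotating both ends
  without breaking \<open>xy\<close> (which costs at most one neighbour at each end) would give an
  \<open>(s, t)\<close>-hole, as in McDiarmid and Yolov's proof of the minimum degree version.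
\<close>

section \<open>Hamiltonian paths as lists, and lists through a prescribed pair\<close>

definition ham_path :: "'a set \<Rightarrow> ('a \<Rightarrow> 'a \<Rightarrow> bool) \<Rightarrow> 'a list \<Rightarrow> 'a \<Rightarrow> 'a \<Rightarrow> bool" where
  "ham_path V E p x y \<longleftrightarrow> p \<noteq> [] \<and> hd p = x \<and> last p = y \<and> distinct p \<and> set p = V \<and> successively E p"

text \<open>
  The pair \<open>xy\<close> must occur consecutively in \<open>p\<close>, but need not be an edge. Phrasing this with
  \<^const>\<open>successively\<close> lets the simplifier track it through appending and reversing lists.
\<close>
definition ham_path_thru :: "'a set \<Rightarrow> ('a \<Rightarrow> 'a \<Rightarrow> bool) \<Rightarrow> 'a \<Rightarrow> 'a \<Rightarrow> 'a list \<Rightarrow> bool" where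
  "ham_path_thru V E x y p \<longleftrightarrow> distinct p \<and> set p = V \<and>
     successively (\<lambda>a b. E a b \<or> {a, b} = {x, y}) p \<and> \<not> successively (\<lambda>a b. {a, b} \<noteq> {x, y}) p"

lemma is_path_if_ham_path: "ham_path V E p x y \<Longrightarrow> is_path V E p x y \<and> set p = V"
  by (auto simp: ham_path_def is_path_def successively_conv_nth)

lemma successively_rev_sym:
  assumes "symp R"
  shows "successively R (rev xs) \<longleftrightarrow> successively R xs"
proof -
  have "(\<lambda>a b. R b a) = R" using assms by (auto simp: symp_def fun_eq_iff)
  then show ?thesis by (metis successively_rev)
qed

lemma ham_path_rev:
  assumes "graph V E" "ham_path V E p x y"
  shows "ham_path V E (rev p) y x"
proof -
  have "symp E" using assms(1) by (auto simp: graph_def symp_def)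
  then show ?thesis using assms(2)
    by (auto simp: ham_path_def hd_rev last_rev successively_rev_sym simp del: successively_rev)
qed

lemma not_successivelyE:
  assumes "\<not> successively P xs"
  obtains ys a b zs where "xs = ys @ a # b # zs" "\<not> P a b"
proof -
  have "\<exists>ys a b zs. xs = ys @ a # b # zs \<and> \<not> P a b"
    using assms
  proof (induction xs)
    case (Cons c xs)
    show ?case
    proof (cases "successively P xs")
      case True
      with Cons.prems obtain d zs where "xs = d # zs" "\<not> P c d"
        by (cases xs) auto
      then show ?thesis by (metis append_Nil)
    next
      case False
      with Cons.IH show ?thesis by (metis append_Cons)
    qed
  qed simp
  with that show ?thesis by blast
qed

text \<open>A consecutive pair equal to \<open>{x, y}\<close> would put both \<open>x\<close> and
  \<open>y\<close> into the list.\<close>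

lemma successively_drop_edge:
  assumes "successively (\<lambda>a b. E a b \<or> {a, b} = {x, y}) p" "\<not> {x, y} \<subseteq> set p"
  shows "successively E p"
proof (rule successively_mono[OF assms(1)])
  fix a b assume "a \<in> set p" "b \<in> set p" "E a b \<or> {a, b} = {x, y}"
  then show "E a b" using assms(2) by (metis empty_subsetI insert_subset)
qed

text \<open>The closing edge makes \<open>p\<close> cyclic; opening the cycle at the pair
  \<open>xy\<close> instead leaves a Hamiltonian path between \<open>x\<close> and
  \<open>y\<close>.\<close>

lemma ham_path_if_cycle_thru:
  assumes G: "graph V E" and p: "ham_path_thru V E x y p" and e: "E (last p) (hd p)"
  shows "\<exists>q. ham_path V E q x y"
proof -
  obtain P a b Q where pe: "p = P @ a # b # Q" and ab: "{a, b} = {x, y}"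
    using p unfolding ham_path_thru_def by (metis (mono_tags, lifting) not_successivelyE)
  let ?F = "\<lambda>u v. E u v \<or> {u, v} = {x, y}"
  have d: "distinct (P @ a # b # Q)" and s: "successively ?F (P @ a # b # Q)"
    using p pe by (auto simp: ham_path_thru_def)
  have "successively ?F (P @ [a])" "successively ?F (b # Q)"
    using s by (auto simp: successively_append_iff successively_Cons)
  \<comment> \<open>By distinctness each side of the cut contains only one of \<open>a\<close> and
    \<open>b\<close>, so all its steps are genuine edges.\<close>
  moreover have "\<not> {x, y} \<subseteq> set (P @ [a])" "\<not> {x, y} \<subseteq> set (b # Q)"
    unfolding ab[symmetric] using d by auto
  ultimately have "successively E (P @ [a])" "successively E (b # Q)"
    by (auto intro: successively_drop_edge)
  moreover have "E (last (b # Q)) (hd (P @ [a]))"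
    using e pe by (auto simp: hd_append split: if_splits)
  ultimately have "successively E ((b # Q) @ P @ [a])"
    by (subst successively_append_iff) auto
  then have h: "ham_path V E ((b # Q) @ P @ [a]) b a"
    using p pe by (auto simp: ham_path_def ham_path_thru_def)
  show ?thesis
  proof (cases "b = x")
    case True
    then have "a = y" using ab by (auto simp: doubleton_eq_iff)
    then show ?thesis using h True by blast
  next
    case False
    then have "b = y" "a = x" using ab by (auto simp: doubleton_eq_iff)
    then show ?thesis using ham_path_rev[OF G h] by blast
  qed
qed

lemma symp_edge_or_pair: "graph V E \<Longrightarrow> symp (\<lambda>a b. E a b \<or> {a, b} = {x, y})"
  by (auto simp: symp_def graph_def insert_commute)

lemma symp_not_pair: "symp (\<lambda>a b. {a, b} \<noteq> {x, y})"
  by (auto simp: symp_def insert_commute)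

section \<open>Rotations that keep the pair \<open>xy\<close> consecutive\<close>

lemmas rotation_simps = successively_rev_sym successively_append_iff hd_rev last_rev

text \<open>Going along \<open>A\<close> and then back along \<open>C\<close> closes up. Only the
  link from \<open>last A\<close> to \<open>hd C\<close> is broken, and \<open>b\<close> keeps it
  from being \<open>xy\<close>.\<close>

lemma rotation_cross:
  assumes G: "graph V E" and p: "ham_path_thru V E x y (A @ C)"
    and ne: "A \<noteq> []" "C \<noteq> []"
    and e: "E (hd A) (hd C)" "E (last C) (last A)" and b: "{last A, hd C} \<noteq> {x, y}"
  shows "\<exists>q. ham_path V E q x y"
proof (rule ham_path_if_cycle_thru[OF G, where p = "A @ rev C"])
  have sym: "\<And>u v. E u v \<Longrightarrow> E v u" using G by (auto simp: graph_def)
  show "ham_path_thru V E x y (A @ rev C)"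
    using p ne b e sym unfolding ham_path_thru_def
    by (auto simp: rotation_simps symp_edge_or_pair[OF G] symp_not_pair simp del: successively_rev)
  show "E (last (A @ rev C)) (hd (A @ rev C))"
    using e ne sym by (auto simp: last_rev)
qed

text \<open>The chords from the two ends land on the two ends of \<open>B\<close>. Traversing
  \<open>rev A\<close>, \<open>B\<close>, \<open>rev C\<close> makes \<open>last A\<close> and
  \<open>hd C\<close> the new ends, which \<open>e'\<close> joins.\<close>

lemma rotation_outer:
  assumes G: "graph V E" and p: "ham_path_thru V E x y (A @ B @ C)"
    and ne: "A \<noteq> []" "B \<noteq> []" "C \<noteq> []"
    and e: "E (hd A) (hd B)" "E (last C) (last B)"
    and b: "{last A, hd B} \<noteq> {x, y}" "{last B, hd C} \<noteq> {x, y}"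
    and e': "E (last A) (hd C)"
  shows "\<exists>q. ham_path V E q x y"
proof (rule ham_path_if_cycle_thru[OF G, where p = "rev A @ B @ rev C"])
  have sym: "\<And>u v. E u v \<Longrightarrow> E v u" using G by (auto simp: graph_def)
  show "ham_path_thru V E x y (rev A @ B @ rev C)"
    using p ne b e sym unfolding ham_path_thru_def
    by (auto simp: rotation_simps symp_edge_or_pair[OF G] symp_not_pair simp del: successively_rev)
  show "E (last (rev A @ B @ rev C)) (hd (rev A @ B @ rev C))"
    using e' ne sym by (auto simp: last_rev hd_rev)
qed

text \<open>Here the chords cross: traversing \<open>rev B\<close>, \<open>rev C\<close>,
  \<open>A\<close> makes \<open>last B\<close> and \<open>last A\<close> the new ends.\<close>

lemma rotation_inner:
  assumes G: "graph V E" and p: "ham_path_thru V E x y (A @ B @ C)"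
    and ne: "A \<noteq> []" "B \<noteq> []" "C \<noteq> []"
    and e: "E (hd A) (hd C)" "E (last C) (hd B)"
    and b: "{last A, hd B} \<noteq> {x, y}" "{last B, hd C} \<noteq> {x, y}"
    and e': "E (last A) (last B)"
  shows "\<exists>q. ham_path V E q x y"
proof (rule ham_path_if_cycle_thru[OF G, where p = "rev B @ rev C @ A"])
  have sym: "\<And>u v. E u v \<Longrightarrow> E v u" using G by (auto simp: graph_def)
  show "ham_path_thru V E x y (rev B @ rev C @ A)"
    using p ne b e sym unfolding ham_path_thru_def
    by (auto simp: rotation_simps symp_edge_or_pair[OF G] symp_not_pair simp del: successively_rev)
  show "E (last (rev B @ rev C @ A)) (hd (rev B @ rev C @ A))"
    using e' ne sym by (auto simp: last_rev hd_rev)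
qed

lemma split_at_two_indices:
  assumes "i < j" "Suc j < length p"
  obtains A B C where "p = A @ B @ C" "A \<noteq> []" "B \<noteq> []" "C \<noteq> []"
    "hd A = p ! 0" "last A = p ! i" "hd B = p ! Suc i" "last B = p ! j" "hd C = p ! Suc j"
    "last C = p ! (length p - 1)"
proof
  let ?A = "take (Suc i) p" and ?B = "drop (Suc i) (take (Suc j) p)" and ?C = "drop (Suc j) p"
  have "?A = take (Suc i) (take (Suc j) p)" using assms by (simp add: min_def)
  then have "?A @ ?B = take (Suc j) p" by (metis append_take_drop_id)
  then show "p = ?A @ ?B @ ?C" by (metis append_assoc append_take_drop_id)
  show ne: "?A \<noteq> []" "?B \<noteq> []" "?C \<noteq> []" using assms by auto
  show "hd ?A = p ! 0" "hd ?B = p ! Suc i" "hd ?C = p ! Suc j"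
    using assms by (subst hd_conv_nth[OF ne(1)] hd_conv_nth[OF ne(2)] hd_conv_nth[OF ne(3)]; simp)+
  show "last ?A = p ! i" "last ?B = p ! j" "last ?C = p ! (length p - 1)"
    using assms by (subst last_conv_nth[OF ne(1)] last_conv_nth[OF ne(2)] last_conv_nth[OF ne(3)];
      simp add: min_def; intro arg_cong[where f = "(!) p"]; simp)+
qed

section \<open>Bipartite holes from positions along a path\<close>

lemma degree_eq_card_index:
  assumes "distinct p" "set p = V"
  shows "degree V E u = card {j. j < length p \<and> E u (p ! j)}"
proof -
  have "{v \<in> V. E u v} = (!) p ` {j. j < length p \<and> E u (p ! j)}"
    using assms(2) by (auto simp: in_set_conv_nth)
  moreover have "inj_on ((!) p) {j. j < length p \<and> E u (p ! j)}"
    using assms(1) by (auto simp: inj_on_def nth_eq_iff_index_eq)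
  ultimately show ?thesis by (simp add: degree_def card_image)
qed

lemma bipartite_hole_if_index_hole:
  assumes p: "distinct p" "set p = V"
    and I: "I \<subseteq> {..<length p}" "s \<le> card I" and J: "J \<subseteq> {..<length p}" "t \<le> card J"
    and d: "I \<inter> J = {}" and n: "\<And>i j. i \<in> I \<Longrightarrow> j \<in> J \<Longrightarrow> \<not> E (p ! i) (p ! j)"
  shows "bipartite_hole V E s t"
proof -
  obtain I' where I': "I' \<subseteq> I" "card I' = s" using I(2) by (meson obtain_subset_with_card_n)
  obtain J' where J': "J' \<subseteq> J" "card J' = t" using J(2) by (meson obtain_subset_with_card_n)
  have inj: "inj_on ((!) p) {..<length p}"
    using p(1) by (auto simp: inj_on_def nth_eq_iff_index_eq)
  have sub: "I' \<subseteq> {..<length p}" "J' \<subseteq> {..<length p}" using I I' J J' by auto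
  show ?thesis unfolding bipartite_hole_def
  proof (rule exI[of _ "(!) p ` I'"], rule exI[of _ "(!) p ` J'"], intro conjI)
    show "(!) p ` I' \<subseteq> V" "(!) p ` J' \<subseteq> V" using sub p(2) by auto
    have "(!) p ` I' \<inter> (!) p ` J' = (!) p ` (I' \<inter> J')"
      using inj sub by (simp add: inj_on_image_Int)
    then show "(!) p ` I' \<inter> (!) p ` J' = {}" using d I'(1) J'(1) by auto
    show "card ((!) p ` I') = s" "card ((!) p ` J') = t"
      using I'(2) J'(2) inj sub by (metis card_image inj_on_subset)+
    show "\<forall>x\<in>(!) p ` I'. \<forall>y\<in>(!) p ` J'. \<not> E x y" using n I'(1) J'(1) by auto
  qed
qed

text \<open>\<open>m\<close> is the \<open>s\<close>-th smallest element of \<open>N\<close>. It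
  counts on both sides, which is why \<open>card N\<close> may fall one short of
  \<open>s + t\<close>.\<close>

lemma obtain_rank_threshold:
  fixes N :: "nat set"
  assumes fin: "finite N" and s: "s > 0" and t: "t > 0" and c: "s + t \<le> Suc (card N)"
  obtains m where "m \<in> N" "s \<le> card {i \<in> N. i \<le> m}" "t \<le> card {i \<in> N. m \<le> i}"
proof -
  define m where "m = (LEAST m. s \<le> card {i \<in> N. i \<le> m})"
  have "{i \<in> N. i \<le> Max N} = N" using fin by auto
  then have "s \<le> card {i \<in> N. i \<le> Max N}" using c t by auto
  then have m1: "s \<le> card {i \<in> N. i \<le> m}" unfolding m_def by (rule LeastI)
  have m2: "card {i \<in> N. i < m} < s"
  proof (cases m)
    case 0
    then show ?thesis using s by simp
  next
    case (Suc m')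
    then have "\<not> s \<le> card {i \<in> N. i \<le> m'}" unfolding m_def by (metis lessI not_less_Least)
    then show ?thesis using Suc by (simp add: less_Suc_eq_le)
  qed
  have "m \<in> N"
  proof (rule ccontr)
    assume "m \<notin> N"
    then have "{i \<in> N. i \<le> m} = {i \<in> N. i < m}" by (auto simp: order_le_less)
    then show False using m1 m2 by simp
  qed
  moreover have "card N = card {i \<in> N. i < m} + card {i \<in> N. m \<le> i}"
    using fin by (subst card_Un_disjoint[symmetric]) (auto intro: arg_cong[where f = card])
  ultimately show ?thesis using that m1 m2 c by simp
qed

text \<open>Two vertices that become the ends after rotations keeping \<open>xy\<close> cannot be
  adjacent, as their edge would close the path up. Enough such pairs form a hole.\<close>

lemma bipartite_hole_if_high_degree_ends:
  assumes G: "graph V E" and no: "\<nexists>q. ham_path V E q x y"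
    and p: "ham_path_thru V E x y p" and s: "s > 0" and t: "t > 0"
    and uv: "\<not> E (p ! 0) (p ! (length p - 1))"
    and du: "s + t \<le> degree V E (p ! 0)" and dv: "s + t \<le> degree V E (p ! (length p - 1))"
  shows "bipartite_hole V E s t"
proof -
  let ?n = "length p"
  have sym: "\<And>a b. E a b \<Longrightarrow> E b a" and irr: "\<And>a. \<not> E a a" using G by (auto simp: graph_def)
  have d: "distinct p" and V: "set p = V" using p by (auto simp: ham_path_thru_def)
  obtain k where k: "Suc k < ?n" "{p ! k, p ! Suc k} = {x, y}"
    using p by (auto simp: ham_path_thru_def successively_conv_nth)
  have other: "{p ! i, p ! Suc i} \<noteq> {x, y}" if "Suc i < ?n" "i \<noteq> k" for i
    unfolding k(2)[symmetric] using that k(1) nth_eq_iff_index_eq[OF d]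
    by (simp add: doubleton_eq_iff)
  \<comment> \<open>Rotating along the chord from the first vertex to \<open>p ! Suc i\<close> turns
    \<open>p ! i\<close> into an end; \<open>i = k\<close> would break \<open>xy\<close>. In
    \<open>M\<close> nothing is excluded yet.\<close>
  define N where "N = {i. Suc i < ?n \<and> i \<noteq> k \<and> E (p ! 0) (p ! Suc i)}"
  define M where "M = {j. j < ?n \<and> E (p ! (?n - 1)) (p ! j)}"
  have finN: "finite N" by (rule finite_subset[of _ "{..<?n}"]) (auto simp: N_def)
  have finM: "finite M" by (auto simp: M_def)
  have cN: "s + t \<le> Suc (card N)"
  proof -
    \<comment> \<open>The only neighbour of \<open>p ! 0\<close> that \<open>N\<close> can miss is
      the one at position \<open>Suc k\<close>.\<close>
    have "{j. j < ?n \<and> E (p ! 0) (p ! j)} \<subseteq> Suc ` insert k N"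
    proof
      fix j assume j: "j \<in> {j. j < ?n \<and> E (p ! 0) (p ! j)}"
      then obtain i where "j = Suc i" using irr by (cases j) auto
      then show "j \<in> Suc ` insert k N" using j by (auto simp: N_def)
    qed
    then have "degree V E (p ! 0) \<le> card (Suc ` insert k N)"
      unfolding degree_eq_card_index[OF d V] using finN by (intro card_mono) auto
    also have "\<dots> = card (insert k N)" by (rule card_image[OF inj_Suc])
    also have "\<dots> \<le> Suc (card N)" by (simp add: card_insert_le_m1 finN card_insert_if)
    finally show ?thesis using du by simp
  qed
  have cM: "s + t \<le> card M"
    using dv unfolding degree_eq_card_index[OF d V] M_def .
  \<comment> \<open>Hence every element of \<open>M\<close> is a successor.\<close>
  have M0: "0 \<notin> M" using uv sym by (auto simp: M_def)
  have Mn: "Suc j < ?n" if "j \<in> M" for j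
  proof -
    have "j \<noteq> ?n - 1" using that irr by (auto simp: M_def)
    then show ?thesis using that by (auto simp: M_def)
  qed
  have cross: "i \<notin> M" if "i \<in> N" for i
  proof
    assume "i \<in> M"
    have i: "Suc i < ?n" "i \<noteq> k" "E (p ! 0) (p ! Suc i)" using that by (auto simp: N_def)
    have j: "E (p ! (?n - 1)) (p ! i)" using \<open>i \<in> M\<close> by (simp add: M_def)
    let ?A = "take (Suc i) p" and ?C = "drop (Suc i) p"
    have ne: "?A \<noteq> []" "?C \<noteq> []" using i(1) by auto
    have ends: "hd ?A = p ! 0" "last ?A = p ! i" "hd ?C = p ! Suc i"
      using i(1) by (simp_all add: hd_conv_nth[OF ne(1)] hd_conv_nth[OF ne(2)]
        last_conv_nth[OF ne(1)] min_def)
    have "last ?C = last p" using i(1) by simp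
    also have "\<dots> = p ! (?n - 1)" using i(1) by (intro last_conv_nth) auto
    finally have endC: "last ?C = p ! (?n - 1)" .
    have p': "ham_path_thru V E x y (?A @ ?C)" using p by simp
    have "\<exists>q. ham_path V E q x y"
      by (rule rotation_cross[OF G p' ne], unfold ends endC) (rule i j other)+
    then show False using no by blast
  qed
  \<comment> \<open>If the chord from the last vertex lands beyond \<open>i\<close>, the new ends
    are \<open>p ! i\<close> and \<open>p ! Suc j\<close>.\<close>
  have outer: "\<not> E (p ! i) (p ! Suc j)" if "i \<in> N" "j \<in> M" "i < j" "j \<noteq> k" for i j
  proof
    assume e: "E (p ! i) (p ! Suc j)"
    obtain A B C where ABC: "p = A @ B @ C" "A \<noteq> []" "B \<noteq> []" "C \<noteq> []"
      "hd A = p ! 0" "last A = p ! i" "hd B = p ! Suc i" "last B = p ! j" "hd C = p ! Suc j"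
      "last C = p ! (?n - 1)"
      using split_at_two_indices[OF \<open>i < j\<close> Mn[OF \<open>j \<in> M\<close>]] .
    have i: "Suc i < ?n" "i \<noteq> k" "E (p ! 0) (p ! Suc i)" using that by (auto simp: N_def)
    have j: "E (p ! (?n - 1)) (p ! j)" using that by (simp add: M_def)
    have p': "ham_path_thru V E x y (A @ B @ C)" using p ABC(1) by metis
    have "\<exists>q. ham_path V E q x y"
      by (rule rotation_outer[OF G p' ABC(2-4)], unfold ABC(5-10))
        (rule i j e other Mn that)+
    then show False using no by blast
  qed
  \<comment> \<open>If it lands before \<open>i\<close>, at \<open>Suc j\<close>, the new end
    opposite \<open>p ! i\<close> is the predecessor \<open>p ! j\<close>.\<close>
  have inner: "\<not> E (p ! j) (p ! i)" if "i \<in> N" "Suc j \<in> M" "Suc j < i" "j \<noteq> k" for i j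
  proof
    assume e: "E (p ! j) (p ! i)"
    have ji: "j < i" "Suc i < ?n" using that by (auto simp: N_def)
    obtain A B C where ABC: "p = A @ B @ C" "A \<noteq> []" "B \<noteq> []" "C \<noteq> []"
      "hd A = p ! 0" "last A = p ! j" "hd B = p ! Suc j" "last B = p ! i" "hd C = p ! Suc i"
      "last C = p ! (?n - 1)"
      using split_at_two_indices[OF ji] .
    have i: "i \<noteq> k" "E (p ! 0) (p ! Suc i)" using that by (auto simp: N_def)
    have j: "Suc j < ?n" "E (p ! (?n - 1)) (p ! Suc j)" using that by (simp_all add: M_def)
    have p': "ham_path_thru V E x y (A @ B @ C)" using p ABC(1) by metis
    have "\<exists>q. ham_path V E q x y"
      by (rule rotation_inner[OF G p' ABC(2-4)], unfold ABC(5-10))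
        (rule i j ji e other that)+
    then show False using no by blast
  qed
  obtain m where m: "m \<in> N" "s \<le> card {i \<in> N. i \<le> m}" "t \<le> card {i \<in> N. m \<le> i}"
    using obtain_rank_threshold[OF finN s t cN] .
  have mk: "m \<noteq> k" using m(1) by (simp add: N_def)
  \<comment> \<open>Chords landing beyond \<open>m\<close> are paired by \<open>outer\<close> with
    the part of \<open>N\<close> up to \<open>m\<close>, those landing before \<open>m\<close> by
    \<open>inner\<close> with the part from \<open>m\<close> on. \<open>L\<close> records
    predecessors.\<close>
  define R where "R = {j \<in> M. m < j \<and> j \<noteq> k}"
  define L where "L = {j. Suc j \<in> M \<and> Suc j < m \<and> j \<noteq> k}"
  have finR: "finite R" using finM by (simp add: R_def)
  have finL: "finite L" by (rule finite_subset[of _ "{..<m}"]) (auto simp: L_def)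
  \<comment> \<open>\<open>k\<close> is excluded from \<open>R\<close> only if \<open>m < k\<close>, and \<open>Suc k\<close> is missing from \<open>Suc ` L\<close> only if \<open>k < m\<close>,
    so the forbidden edge costs the last vertex one neighbour in total.\<close>
  have "\<exists>c. M \<subseteq> insert c (R \<union> Suc ` L)"
  proof (intro exI subsetI)
    fix j assume j: "j \<in> M"
    then obtain i where i: "j = Suc i" using M0 by (cases j) auto
    have "j \<noteq> m" using cross m(1) j by blast
    show "j \<in> insert (if m < k then k else Suc k) (R \<union> Suc ` L)"
    proof (cases "m < j")
      case True
      then show ?thesis using j mk by (auto simp: R_def)
    next
      case False
      then show ?thesis using j i \<open>j \<noteq> m\<close> mk by (auto simp: L_def)
    qed
  qed
  then obtain c where c: "M \<subseteq> insert c (R \<union> Suc ` L)" by blast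
  have "card M \<le> card (insert c (R \<union> Suc ` L))" using c finR finL by (intro card_mono) auto
  also have "\<dots> \<le> Suc (card (R \<union> Suc ` L))" using finR finL by (simp add: card_insert_if)
  also have "card (R \<union> Suc ` L) \<le> card R + card (Suc ` L)" by (rule card_Un_le)
  also have "card (Suc ` L) = card L" by (simp add: card_image)
  finally have "s + t \<le> Suc (card R + card L)" using cM by simp
  \<comment> \<open>If both failed, \<open>card R + card L\<close> would be at most
    \<open>s + t - 2\<close>.\<close>
  then consider "t \<le> card R" | "s \<le> card L" by linarith
  then show ?thesis
  proof cases
    case 1
    show ?thesis
    proof (rule bipartite_hole_if_index_hole[OF d V, of "{i \<in> N. i \<le> m}" s "Suc ` R" t])
      show "t \<le> card (Suc ` R)" using 1 by (simp add: card_image)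
      show "\<not> E (p ! i) (p ! j)" if "i \<in> {i \<in> N. i \<le> m}" "j \<in> Suc ` R" for i j
        using that outer by (auto simp: R_def)
    qed (use m Mn in \<open>auto simp: N_def R_def\<close>)
  next
    case 2
    show ?thesis
    proof (rule bipartite_hole_if_index_hole[OF d V, of L s "{i \<in> N. m \<le> i}" t])
      show "\<not> E (p ! j) (p ! i)" if "j \<in> L" "i \<in> {i \<in> N. m \<le> i}" for i j
        using that inner by (auto simp: L_def)
      show "L \<subseteq> {..<?n}" using Mn by (force simp: L_def)
    qed (use m 2 in \<open>auto simp: N_def L_def\<close>)
  qed
qed


section \<open>Graphs covered by two disjoint cliques\<close>

lemma ham_path_clique:
  assumes fin: "finite S" and ab: "a \<in> S" "b \<in> S" "a = b \<Longrightarrow> S = {a}"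
    and E: "\<And>u v. u \<in> S \<Longrightarrow> v \<in> S \<Longrightarrow> u \<noteq> v \<Longrightarrow> E u v"
  shows "\<exists>p. ham_path S E p a b"
proof (cases "a = b")
  case True
  \<comment> \<open>The one-vertex path serves segments that shrink to a point.\<close>
  then show ?thesis using ab by (intro exI[of _ "[a]"]) (auto simp: ham_path_def)
next
  case False
  obtain zs where zs: "set zs = S - {a, b}" "distinct zs"
    using fin finite_distinct_list by (metis finite_Diff)
  let ?p = "a # zs @ [b]"
  have set: "set ?p = S" and d: "distinct ?p" using zs ab False by auto
  have "E (?p ! i) (?p ! Suc i)" if "Suc i < length ?p" for i
  proof (rule E)
    show "?p ! i \<in> S" "?p ! Suc i \<in> S" using that set by (metis Suc_lessD nth_mem)+
    show "?p ! i \<noteq> ?p ! Suc i" using that d by (metis Suc_lessD n_not_Suc_n nth_eq_iff_index_eq)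
  qed
  then have "successively E ?p" unfolding successively_conv_nth by blast
  then show ?thesis using set d by (intro exI[of _ ?p]) (auto simp: ham_path_def)
qed

lemma ham_path_append:
  assumes "ham_path S E p a b" "ham_path T E q c d" "E b c" "S \<inter> T = {}"
  shows "ham_path (S \<union> T) E (p @ q) a d"
  using assms by (auto simp: ham_path_def successively_append_iff)

text \<open>A walk from \<open>A\<close> to \<open>B\<close> inside \<open>V - X\<close> has to
  cross over somewhere.\<close>

lemma cut_edge:
  assumes "k_connected k V E" "X \<subseteq> V" "card X < k" "A \<noteq> {}" "B \<noteq> {}"
    "A \<inter> B = {}" "A \<union> B = V - X"
  obtains a b where "a \<in> A" "b \<in> B" "E a b"
proof -
  let ?R = "\<lambda>a b. E a b \<and> a \<in> V - X \<and> b \<in> V - X"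
  obtain a0 b0 where a0: "a0 \<in> A" and b0: "b0 \<in> B" using assms by auto
  have "connected_on (V - X) E" using assms(1-3) by (simp add: k_connected_def)
  moreover have "a0 \<in> V - X" "b0 \<in> V - X" using a0 b0 assms(7) by auto
  ultimately have r: "?R\<^sup>*\<^sup>* a0 b0" by (simp only: connected_on_def)
  have "c \<in> A \<or> (\<exists>a\<in>A. \<exists>b\<in>B. E a b)" if "?R\<^sup>*\<^sup>* a0 c" for c
    using that
  proof (induction rule: rtranclp_induct)
    case (step c d)
    then have "d \<in> A \<union> B" using assms(7) by simp
    with step show ?case by blast
  qed (use a0 in auto)
  from this[OF r] show ?thesis using b0 assms(6) that by blast
qed

text \<open>Run from \<open>x\<close> to \<open>p1\<close> inside \<open>A\<close>, through all of
  \<open>B\<close> from \<open>q1\<close> to \<open>q2\<close>, then from \<open>p2\<close> to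
  \<open>y\<close> through the rest of \<open>A\<close>. A segment with equal ends must be a single
  vertex, hence the conditional assumptions.\<close>

lemma ham_path_detour:
  assumes G: "graph V E" and AB: "A \<inter> B = {}" "A \<union> B = V"
    and A: "\<And>u v. u \<in> A \<Longrightarrow> v \<in> A \<Longrightarrow> u \<noteq> v \<Longrightarrow> E u v"
    and B: "\<And>u v. u \<in> B \<Longrightarrow> v \<in> B \<Longrightarrow> u \<noteq> v \<Longrightarrow> E u v"
    and xy: "x \<in> A" "y \<in> A" "x \<noteq> y"
    and p: "p1 \<in> A" "p2 \<in> A" "p1 \<noteq> p2" "p1 \<noteq> y" "p2 \<noteq> x"
    and A_trivial: "p1 = x \<Longrightarrow> p2 = y \<Longrightarrow> A = {x, y}"
    and q: "q1 \<in> B" "q2 \<in> B" "q1 = q2 \<Longrightarrow> B = {q1}"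
    and e: "E p1 q1" "E p2 q2"
  shows "\<exists>r. ham_path V E r x y"
proof -
  have fin: "finite A" "finite B" using G AB by (auto simp: graph_def)
  \<comment> \<open>If \<open>p2 = y\<close>, the last segment is \<open>y\<close> alone and the
    first takes the rest of \<open>A\<close>; otherwise the first is kept minimal.\<close>
  define X where "X = (if p2 = y then A - {y} else {x, p1})"
  have X: "X \<subseteq> A" "x \<in> X" "p1 \<in> X" "p2 \<notin> X" "y \<notin> X"
    "x = p1 \<Longrightarrow> X = {x}" "p2 = y \<Longrightarrow> A - X = {p2}"
    using xy p A_trivial by (auto simp: X_def)
  obtain r1 where r1: "ham_path X E r1 x p1"
    using ham_path_clique[of X x p1 E] X A fin by (metis finite_subset subsetD)
  obtain r2 where r2: "ham_path B E r2 q1 q2"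
    using ham_path_clique[of B q1 q2 E] q B fin by metis
  obtain r3 where r3: "ham_path (A - X) E r3 p2 y"
    using ham_path_clique[of "A - X" p2 y E] X A fin p xy by (metis DiffD1 DiffI finite_Diff)
  have "E q2 p2" using G e by (auto simp: graph_def)
  then have "ham_path (X \<union> (B \<union> (A - X))) E (r1 @ r2 @ r3) x y"
    using X AB e by (intro ham_path_append[OF r1 ham_path_append[OF r2 r3]]) auto
  also have "X \<union> (B \<union> (A - X)) = V" using X AB by auto
  finally show ?thesis by blast
qed

text \<open>For non-empty \<open>B\<close>, small cuts yield two edges to leave and re-enter
  \<open>A\<close>, with distinct ends in \<open>A\<close>, and in \<open>B\<close> too unless
  \<open>B\<close> is a single vertex.\<close>

lemma ham_path_two_cliques_same:
  assumes G: "graph V E" and k: "k_connected 3 V E" and AB: "A \<inter> B = {}" "A \<union> B = V"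
    and A: "\<And>u v. u \<in> A \<Longrightarrow> v \<in> A \<Longrightarrow> u \<noteq> v \<Longrightarrow> E u v"
    and B: "\<And>u v. u \<in> B \<Longrightarrow> v \<in> B \<Longrightarrow> u \<noteq> v \<Longrightarrow> E u v"
    and xy: "x \<in> A" "y \<in> A" "x \<noteq> y"
  shows "\<exists>r. ham_path V E r x y"
proof (cases "B = {}")
  case True
  then have "A = V" using AB(2) by simp
  moreover have "finite V" using G by (simp add: graph_def)
  ultimately show ?thesis using ham_path_clique[of A x y E] A xy by simp
next
  case False
  \<comment> \<open>If \<open>A\<close> has further vertices, deleting \<open>x\<close> and
    \<open>y\<close> makes \<open>p1\<close> one of them; otherwise deleting \<open>y\<close> forces
    \<open>p1 = x\<close>.\<close>
  obtain p1 q1 where 1: "p1 \<in> A" "q1 \<in> B" "E p1 q1" "p1 \<noteq> y" "p1 = x \<Longrightarrow> A = {x, y}"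
  proof (cases "A = {x, y}")
    case True
    obtain q where "q \<in> B" "E x q"
    proof (rule cut_edge[OF k, of "{y}" "{x}" B])
      show "{x} \<union> B = V - {y}" using True xy AB by blast
    qed (use xy AB False in auto)
    then show ?thesis using that xy True by metis
  next
    case A_big: False
    obtain p q where "p \<in> A - {x, y}" "q \<in> B" "E p q"
    proof (rule cut_edge[OF k, of "{x, y}" "A - {x, y}" B])
      show "A - {x, y} \<union> B = V - {x, y}" using xy AB by blast
    qed (use A_big xy AB False in \<open>auto simp: card_insert_if\<close>)
    then show ?thesis using that by blast
  qed
  have A1: "A - {p1} \<noteq> {}" using xy by auto
  \<comment> \<open>Deleting \<open>p1\<close> forces a new end in \<open>A\<close>;
    \<open>q1\<close> is deleted too unless it is all of \<open>B\<close>.\<close>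
  obtain p2 q2 where 2: "p2 \<in> A" "q2 \<in> B" "E p2 q2" "p2 \<noteq> p1" "q1 = q2 \<Longrightarrow> B = {q1}"
  proof (cases "B = {q1}")
    case True
    obtain p q where "p \<in> A - {p1}" "q \<in> B" "E p q"
    proof (rule cut_edge[OF k, of "{p1}" "A - {p1}" B])
      show "A - {p1} \<union> B = V - {p1}" using 1 AB by blast
    qed (use A1 1(1) AB False in auto)
    then show ?thesis using that True by blast
  next
    case B_big: False
    obtain p q where "p \<in> A - {p1}" "q \<in> B - {q1}" "E p q"
    proof (rule cut_edge[OF k, of "{p1, q1}" "A - {p1}" "B - {q1}"])
      show "A - {p1} \<union> (B - {q1}) = V - {p1, q1}" "{p1, q1} \<subseteq> V" using 1 AB by blast+
      show "B - {q1} \<noteq> {}" using B_big 1 by blast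
      show "(A - {p1}) \<inter> (B - {q1}) = {}" using AB by blast
    qed (use A1 in \<open>auto simp: card_insert_if\<close>)
    then show ?thesis using that by blast
  qed
  show ?thesis
  \<comment> \<open>The segment after the detour must not begin at \<open>x\<close>, so in that case
    the two edges swap roles.\<close>
  proof (cases "p2 = x")
    case True
    show ?thesis
      by (rule ham_path_detour[OF G AB A B xy, of p2 p1 q2 q1]) (use 1 2 xy True in metis)+
  next
    case False
    show ?thesis
      by (rule ham_path_detour[OF G AB A B xy, of p1 p2 q1 q2]) (use 1 2 xy False in metis)+
  qed
qed

text \<open>One edge between the cliques suffices if it avoids \<open>x\<close> and
  \<open>y\<close>, except where one of them is its whole clique. Deleting at most two vertices
  enforces this.\<close>

lemma ham_path_two_cliques_across:
  assumes G: "graph V E" and k: "k_connected 3 V E" and AB: "A \<inter> B = {}" "A \<union> B = V"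
    and A: "\<And>u v. u \<in> A \<Longrightarrow> v \<in> A \<Longrightarrow> u \<noteq> v \<Longrightarrow> E u v"
    and B: "\<And>u v. u \<in> B \<Longrightarrow> v \<in> B \<Longrightarrow> u \<noteq> v \<Longrightarrow> E u v"
    and xy: "x \<in> A" "y \<in> B"
  shows "\<exists>r. ham_path V E r x y"
proof -
  have fin: "finite A" "finite B" using G AB by (auto simp: graph_def)
  have "x \<noteq> y" using xy AB by auto
  define A' where "A' = (if A = {x} then {x} else A - {x})"
  define B' where "B' = (if B = {y} then {y} else B - {y})"
  have A': "A' \<subseteq> A" "A' \<noteq> {}" "x \<in> A' \<Longrightarrow> A = {x}" using xy by (auto simp: A'_def split: if_splits)
  have B': "B' \<subseteq> B" "B' \<noteq> {}" "y \<in> B' \<Longrightarrow> B = {y}" using xy by (auto simp: B'_def split: if_splits)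
  have X: "V - (A' \<union> B') \<subseteq> {x, y}" using AB by (auto simp: A'_def B'_def)
  have "card (V - (A' \<union> B')) \<le> card {x, y}" using X by (intro card_mono) auto
  then have c: "card (V - (A' \<union> B')) < 3" using \<open>x \<noteq> y\<close> by simp
  obtain p q where e: "p \<in> A'" "q \<in> B'" "E p q"
    by (rule cut_edge[OF k _ c, of A' B']) (use A' B' AB in auto)
  obtain r1 where r1: "ham_path A E r1 x p"
    using ham_path_clique[of A x p E] A' A fin e xy by (metis subsetD)
  obtain r2 where r2: "ham_path B E r2 q y"
    using ham_path_clique[of B q y E] B' B fin e xy by (metis subsetD)
  show ?thesis using ham_path_append[OF r1 r2 e(3) AB(1)] AB(2) by auto
qed

lemma ham_path_two_cliques:
  assumes G: "graph V E" and k: "k_connected 3 V E" and AB: "A \<inter> B = {}" "A \<union> B = V"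
    and A: "\<And>u v. u \<in> A \<Longrightarrow> v \<in> A \<Longrightarrow> u \<noteq> v \<Longrightarrow> E u v"
    and B: "\<And>u v. u \<in> B \<Longrightarrow> v \<in> B \<Longrightarrow> u \<noteq> v \<Longrightarrow> E u v"
    and xy: "x \<in> V" "y \<in> V" "x \<noteq> y"
  shows "\<exists>r. ham_path V E r x y"
proof -
  have BA: "B \<inter> A = {}" "B \<union> A = V" using AB by auto
  consider "x \<in> A" "y \<in> A" | "x \<in> A" "y \<in> B" | "x \<in> B" "y \<in> A" | "x \<in> B" "y \<in> B"
    using xy AB by auto
  then show ?thesis
  proof cases
    case 1
    show ?thesis by (rule ham_path_two_cliques_same[OF G k AB A B 1 xy(3)])
  next
    case 2
    show ?thesis by (rule ham_path_two_cliques_across[OF G k AB A B 2])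
  next
    case 3
    show ?thesis by (rule ham_path_two_cliques_across[OF G k BA B A 3])
  next
    case 4
    show ?thesis by (rule ham_path_two_cliques_same[OF G k BA B A 4 xy(3)])
  qed
qed

section \<open>Induction by adding edges between high vertices\<close>

lemma k_connected_mono:
  assumes "k_connected k V E" "\<And>a b. E a b \<Longrightarrow> F a b"
  shows "k_connected k V F"
proof -
  have "connected_on S F" if "connected_on S E" for S
  proof -
    have "(\<lambda>a b. E a b \<and> a \<in> S \<and> b \<in> S)\<^sup>*\<^sup>* \<le> (\<lambda>a b. F a b \<and> a \<in> S \<and> b \<in> S)\<^sup>*\<^sup>*"
      by (intro rtranclp_mono) (use assms(2) in auto)
    then show ?thesis using that unfolding connected_on_def by blast
  qed
  then show ?thesis using assms(1) by (auto simp: k_connected_def)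
qed

text \<open>Cut \<open>q\<close> at the new edge into a piece from \<open>x\<close> to
  \<open>a\<close> and one from \<open>b\<close> to \<open>y\<close>. Reversing both puts
  \<open>x\<close> next to \<open>y\<close> and makes \<open>a\<close> and \<open>b\<close> the
  ends.\<close>

lemma ham_path_thru_if_ham_path_add_edge:
  assumes G: "graph V E" and q: "ham_path V (\<lambda>a b. E a b \<or> {a, b} = {u, v}) q x y"
    and no: "\<not> ham_path V E q x y"
  obtains p a b where "ham_path_thru V E x y p" "{a, b} = {u, v}" "p \<noteq> []" "hd p = a" "last p = b"
proof -
  have "\<not> successively (\<lambda>a b. {a, b} \<noteq> {u, v}) q"
  proof
    assume "successively (\<lambda>a b. {a, b} \<noteq> {u, v}) q"
    moreover have "successively (\<lambda>a b. E a b \<or> {a, b} = {u, v}) q"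
      using q by (simp add: ham_path_def)
    ultimately have "successively E q" by (auto simp: successively_conv_nth)
    then show False using q no by (simp add: ham_path_def)
  qed
  then obtain P a b Q where pe: "q = P @ a # b # Q" and ab: "{a, b} = {u, v}"
    by (metis (mono_tags, lifting) not_successivelyE)
  let ?F = "\<lambda>a b. E a b \<or> {a, b} = {u, v}" and ?H = "\<lambda>a b. E a b \<or> {a, b} = {x, y}"
  let ?S = "P @ [a]" and ?T = "b # Q"
  have d: "distinct (P @ a # b # Q)" and s: "successively ?F (P @ a # b # Q)" and V: "set q = V"
    and h: "hd ?S = x" "last ?T = y"
    using q pe by (auto simp: ham_path_def hd_append)
  have "successively ?F ?S" "successively ?F ?T"
    using s by (auto simp: successively_append_iff successively_Cons)
  moreover have "\<not> {u, v} \<subseteq> set ?S" "\<not> {u, v} \<subseteq> set ?T"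
    unfolding ab[symmetric] using d by auto
  ultimately have ST: "successively E ?S" "successively E ?T"
    by (auto intro: successively_drop_edge)
  have H: "successively ?H ?S" "successively ?H ?T"
    by (rule successively_mono[OF ST(1)] successively_mono[OF ST(2)], simp)+
  have ends: "rev ?S \<noteq> []" "rev ?T \<noteq> []" "last (rev ?S) = x" "hd (rev ?T) = y"
    using h by (simp_all only: last_rev hd_rev) simp_all
  have "successively ?H (rev ?S)" "successively ?H (rev ?T)"
    using H by (simp_all only: successively_rev_sym[OF symp_edge_or_pair[OF G]])
  then have "successively ?H (rev ?S @ rev ?T)"
    unfolding successively_append_iff ends(3,4) by blast
  moreover have "\<not> successively (\<lambda>a b. {a, b} \<noteq> {x, y}) (rev ?S @ rev ?T)"
    unfolding successively_append_iff ends(3,4) using ends(1,2) by blast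
  ultimately have "ham_path_thru V E x y (rev ?S @ rev ?T)"
    using d V pe by (auto simp: ham_path_thru_def)
  then show ?thesis by (rule that[OF _ ab]) auto
qed

text \<open>Fixing \<open>s\<close> and \<open>t\<close> instead of the bipartite-hole-number makes
  the hypotheses pass directly to graphs with more edges.\<close>

lemma ham_path_if_degree_sums:
  assumes "graph V E" "k_connected 3 V E" "\<not> bipartite_hole V E s t"
    and "\<And>u v. u \<in> V \<Longrightarrow> v \<in> V \<Longrightarrow> u \<noteq> v \<Longrightarrow> \<not> E u v \<Longrightarrow>
      2 * (s + t) \<le> Suc (degree V E u + degree V E v)"
    and s: "s > 0" and t: "t > 0" and xy: "x \<in> V" "y \<in> V" "x \<noteq> y"
  shows "\<exists>p. ham_path V E p x y"
  using assms(1-4)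
proof (induction "card {(u, v). u \<in> V \<and> v \<in> V \<and> \<not> E u v}" arbitrary: E rule: less_induct)
  case less
  note G = less.prems(1)
  have fin: "finite V" and sym: "\<And>a b. E a b \<Longrightarrow> E b a" using G by (auto simp: graph_def)
  define H where "H = {u \<in> V. s + t \<le> degree V E u}"
  show ?case
  proof (cases "\<forall>u\<in>H. \<forall>v\<in>H. u \<noteq> v \<longrightarrow> E u v")
    case True
    show ?thesis
    proof (rule ham_path_two_cliques[OF G less.prems(2), of H "V - H"])
      \<comment> \<open>Two non-adjacent low vertices would have degree sum at most
        \<open>2 * (s + t) - 2\<close>.\<close>
      show "E u v" if "u \<in> V - H" "v \<in> V - H" "u \<noteq> v" for u v
        using that less.prems(4)[of u v] by (fastforce simp: H_def)
    qed (use xy True in \<open>auto simp: H_def\<close>)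
  next
    case False
    then obtain u v where uv: "u \<in> H" "v \<in> H" "u \<noteq> v" "\<not> E u v" by blast
    then have uvV: "u \<in> V" "v \<in> V" by (auto simp: H_def)
    let ?F = "\<lambda>a b. E a b \<or> {a, b} = {u, v}"
    have deg: "degree V E w \<le> degree V ?F w" for w
      unfolding degree_def using fin by (intro card_mono) auto
    have "\<exists>q. ham_path V ?F q x y"
    proof (rule less.hyps)
      have "{(u, v). u \<in> V \<and> v \<in> V \<and> \<not> E u v} \<subseteq> V \<times> V" by auto
      then have "finite {(u, v). u \<in> V \<and> v \<in> V \<and> \<not> E u v}"
        using fin by (meson finite_SigmaI finite_subset)
      then show "card {(a, b). a \<in> V \<and> b \<in> V \<and> \<not> ?F a b} < card {(u, v). u \<in> V \<and> v \<in> V \<and> \<not> E u v}"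
        by (rule psubset_card_mono) (use uv uvV in blast)
      show "graph V ?F" using G uv uvV by (auto simp: graph_def doubleton_eq_iff)
      show "k_connected 3 V ?F" using less.prems(2) by (rule k_connected_mono) simp
      show "\<not> bipartite_hole V ?F s t" using less.prems(3) unfolding bipartite_hole_def by blast
      show "2 * (s + t) \<le> Suc (degree V ?F a + degree V ?F b)"
        if "a \<in> V" "b \<in> V" "a \<noteq> b" "\<not> ?F a b" for a b
        using less.prems(4)[of a b] that deg[of a] deg[of b] by linarith
    qed
    then obtain q where q: "ham_path V ?F q x y" by blast
    show ?thesis
    proof (rule ccontr)
      assume no: "\<nexists>p. ham_path V E p x y"
      then have "\<not> ham_path V E q x y" by blast
      with G q obtain p a b where p: "ham_path_thru V E x y p" "{a, b} = {u, v}" "p \<noteq> []"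
        "hd p = a" "last p = b"
        by (rule ham_path_thru_if_ham_path_add_edge)
      have ends: "p ! 0 = a" "p ! (length p - 1) = b"
        using p by (auto simp: hd_conv_nth last_conv_nth)
      have "\<not> E a b" "a \<in> H" "b \<in> H" using uv p(2) sym by (auto simp: doubleton_eq_iff)
      then have "bipartite_hole V E s t"
        by (intro bipartite_hole_if_high_degree_ends[OF G no p(1) s t]) (auto simp: ends[simplified] H_def)
      then show False using less.prems(3) by blast
    qed
  qed
qed

section \<open>The bipartite-hole-number and the degree sum bound\<close>

lemma bip_hole_number_witness:
  assumes "finite V"
  obtains s t where "s > 0" "t > 0" "s + t = bip_hole_number V E + 1" "\<not> bipartite_hole V E s t"
proof -
  let ?P = "\<lambda>k. \<exists>s t. s > 0 \<and> t > 0 \<and> s + t = k + 1 \<and> \<not> bipartite_hole V E s t"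
  \<comment> \<open>No subset of \<open>V\<close> has \<open>Suc (card V)\<close> elements, so the
    \<open>LEAST\<close> is attained.\<close>
  have "\<not> bipartite_hole V E (Suc (card V)) 1"
    using assms card_mono by (fastforce simp: bipartite_hole_def)
  then have "?P (Suc (card V))" by (intro exI[of _ "Suc (card V)"] exI[of _ 1]) auto
  then have "?P (bip_hole_number V E)" unfolding bip_hole_number_def by (rule LeastI)
  then show ?thesis using that by blast
qed

lemma sigma2_le:
  assumes "finite V" "u \<in> V" "v \<in> V" "u \<noteq> v" "\<not> E u v"
  shows "sigma2 V E \<le> enat (degree V E u + degree V E v)"
proof -
  let ?D = "{degree V E u + degree V E v | u v. u \<in> V \<and> v \<in> V \<and> u \<noteq> v \<and> \<not> E u v}"
  have "?D \<subseteq> (\<lambda>(u, v). degree V E u + degree V E v) ` (V \<times> V)" by auto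
  then have "finite ?D" using assms(1) by (meson finite_SigmaI finite_imageI finite_subset)
  then have "Min ?D \<le> degree V E u + degree V E v" by (rule Min_le) (use assms in blast)
  then show ?thesis using assms by (auto simp: sigma2_def complete_graph_def)
qed

theorem mainTheorem3:
  fixes V :: "'a set" and E :: "'a \<Rightarrow> 'a \<Rightarrow> bool"
  assumes "graph V E"
    and "k_connected 3 V E"
    and "sigma2 V E \<ge> enat (2 * bip_hole_number V E + 1)"
  shows "hamiltonian_connected V E"
proof -
  have fin: "finite V" using assms(1) by (simp add: graph_def)
  obtain s t where st: "s > 0" "t > 0" "s + t = bip_hole_number V E + 1" "\<not> bipartite_hole V E s t"
    using bip_hole_number_witness[OF fin] .
  \<comment> \<open>\<open>2 * (s + t)\<close> exceeds the assumed bound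
    \<open>2 * bip_hole_number V E + 1\<close> by exactly one, hence \<open>Suc\<close>.\<close>
  have "2 * (s + t) \<le> Suc (degree V E u + degree V E v)"
    if "u \<in> V" "v \<in> V" "u \<noteq> v" "\<not> E u v" for u v
  proof -
    have "enat (2 * bip_hole_number V E + 1) \<le> enat (degree V E u + degree V E v)"
      using assms(3) sigma2_le[of V u v E, OF fin that] by (rule order_trans)
    then show ?thesis using st(3) by simp
  qed
  then have "\<exists>p. ham_path V E p x y" if "x \<in> V" "y \<in> V" "x \<noteq> y" for x y
    using ham_path_if_degree_sums[OF assms(1,2) st(4) _ st(1,2) that] by blast
  then show ?thesis
    unfolding hamiltonian_connected_def using is_path_if_ham_path by metis
qed

end
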